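(* Let $G$ be a connected graph with at least three vertices. Then $$\delta(H^*(G,x)) > \frac{1}{MH(G) + 1},\quad \delta(Sc^*(G,x)) > \frac{1}{MS(G) + 1},\quad \delta(Gut^*(G,x)) > \frac{1}{MG(G) + 1},\quad \delta(H_e^*(G,x)) > \frac{1}{MH_e(G) + 1}.$$
   Context: For a connected graph $G$, $d(a,b)$ is the shortest-path distance between vertices, $\deg(a)$ the degree of $a$, and the distance $d(e,f)$ between edges $e,f$ is their distance as vertices of the line graph $L(G)$. For $k\ge1$ let $V_k(G)$ be the set of unordered pairs of vertices at distance $k$ and $E_k(G)$ the set of unordered pairs of edges at distance $k$; set $d_k(G)=|V_k(G)|$, $d_k^e(G)=|E_k(G)|$, $s_k(G)=\sum_{\{a,b\}\in V_k(G)}(\deg(a)+\deg(b))$, $g_k(G)=\sum_{\{a,b\}\in V_k(G)}\deg(a)\deg(b)$ (empty sums are $0$). Define $H(G,x)=\sum_{k\ge1}d_k(G)x^k$, $H_e(G,x)=\sum_{k\ge1}d^e_k(G)x^k$, $Sc(G,x)=\sum_{k\ge1}s_k(G)x^k$, $Gut(G,x)=\sum_{k\ge1}g_k(G)x^k$, and $MH(G)=\max_k d_k(G)$, $MH_e(G)=\max_k d^e_k(G)$, $MS(G)=\max_k s_k(G)$, $MG(G)=\max_k g_k(G)$. Set $H^*=1-H$, $H_e^*=1-H_e$, $Sc^*=1-Sc$, $Gut^*=1-Gut$. Fact (used as known): if $Q(x)=q_1x+\dots+q_mx^m$ with all $q_i\ge 0$ and $\sum q_i\geq 1$, then $Q^*=1-Q$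 has a unique positive root $\delta(Q^* )$, lying in $(0,1]$; this applies to each of $H,H_e,Sc,Gut$ for connected $G$ with at least three vertices. *)

theory Defs
  imports
    "Graph_Theory.Graph_Theory"
    "HOL-Computational_Algebra.Polynomial"
begin

text \<open>
  A finite simple graph is a symmetric digraph satisfying the locale predicate \<^const>\<open>graph\<close>:
  an edge is represented by its two opposite arcs, so the degree of a vertex is its out-degree,
  and the undirected edges are the two-element sets of ends of arcs.
\<close>

definition vertex_dist :: "('a, 'b) pre_digraph \<Rightarrow> 'a \<Rightarrow> 'a \<Rightarrow> ereal" where
  "vertex_dist G a b = wf_digraph.\<mu> G (\<lambda>_. 1) a b"

definition degree_of :: "('a, 'b) pre_digraph \<Rightarrow> 'a \<Rightarrow> nat" where
  "degree_of G v = out_degree G v"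

definition edges_of :: "('a, 'b) pre_digraph \<Rightarrow> 'a set set" where
  "edges_of G = (\<lambda>e. {tail G e, head G e}) ` arcs G"

definition line_graph :: "('a, 'b) pre_digraph \<Rightarrow> ('a set, 'a set \<times> 'a set) pre_digraph" where
  "line_graph G =
    \<lparr> verts = edges_of G,
      arcs = {(e, f). e \<in> edges_of G \<and> f \<in> edges_of G \<and> e \<noteq> f \<and> e \<inter> f \<noteq> {}},
      tail = fst, head = snd \<rparr>"

definition edge_dist :: "('a, 'b) pre_digraph \<Rightarrow> 'a set \<Rightarrow> 'a set \<Rightarrow> ereal" where
  "edge_dist G e f = vertex_dist (line_graph G) e f"

text \<open>
  Unordered pairs are two-element sets; for \<open>k \<ge> 1\<close> the two members below are automatically distinct.
\<close>

definition vertex_pairs :: "('a, 'b) pre_digraph \<Rightarrow> nat \<Rightarrow> 'a set set" where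
  "vertex_pairs G k =
    {{a, b} | a b. a \<in> verts G \<and> b \<in> verts G \<and> vertex_dist G a b = ereal (real k)}"

definition edge_pairs :: "('a, 'b) pre_digraph \<Rightarrow> nat \<Rightarrow> 'a set set set" where
  "edge_pairs G k =
    {{e, f} | e f. e \<in> edges_of G \<and> f \<in> edges_of G \<and> edge_dist G e f = ereal (real k)}"

definition d_num :: "('a, 'b) pre_digraph \<Rightarrow> nat \<Rightarrow> nat" where
  "d_num G k = card (vertex_pairs G k)"

definition de_num :: "('a, 'b) pre_digraph \<Rightarrow> nat \<Rightarrow> nat" where
  "de_num G k = card (edge_pairs G k)"

definition s_num :: "('a, 'b) pre_digraph \<Rightarrow> nat \<Rightarrow> nat" where
  "s_num G k = (\<Sum>p\<in>vertex_pairs G k. \<Sum>v\<in>p. degree_of G v)"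

definition g_num :: "('a, 'b) pre_digraph \<Rightarrow> nat \<Rightarrow> nat" where
  "g_num G k = (\<Sum>p\<in>vertex_pairs G k. \<Prod>v\<in>p. degree_of G v)"

text \<open>
  The polynomial \<open>\<Sum>k\<ge>1. c k * x ^ k\<close> of a sequence with finite support; the sequences above have
  finite support because finite graphs have only finitely many distances.
\<close>

definition gen_poly :: "(nat \<Rightarrow> nat) \<Rightarrow> real poly" where
  "gen_poly c = (\<Sum>k | 1 \<le> k \<and> c k \<noteq> 0. monom (real (c k)) k)"

definition max_coeff :: "(nat \<Rightarrow> nat) \<Rightarrow> nat" where
  "max_coeff c = Max (c ` {1..})"

definition Hosoya :: "('a, 'b) pre_digraph \<Rightarrow> real poly" where
  "Hosoya G = gen_poly (d_num G)"

definition edge_Hosoya :: "('a, 'b) pre_digraph \<Rightarrow> real poly" where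
  "edge_Hosoya G = gen_poly (de_num G)"

definition Schultz :: "('a, 'b) pre_digraph \<Rightarrow> real poly" where
  "Schultz G = gen_poly (s_num G)"

definition Gutman :: "('a, 'b) pre_digraph \<Rightarrow> real poly" where
  "Gutman G = gen_poly (g_num G)"

definition MH :: "('a, 'b) pre_digraph \<Rightarrow> nat" where
  "MH G = max_coeff (d_num G)"

definition MHe :: "('a, 'b) pre_digraph \<Rightarrow> nat" where
  "MHe G = max_coeff (de_num G)"

definition MS :: "('a, 'b) pre_digraph \<Rightarrow> nat" where
  "MS G = max_coeff (s_num G)"

definition MG :: "('a, 'b) pre_digraph \<Rightarrow> nat" where
  "MG G = max_coeff (g_num G)"

definition star :: "real poly \<Rightarrow> real poly" where
  "star Q = 1 - Q"

definition pos_root :: "real poly \<Rightarrow> real" where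
  "pos_root P = (THE x. 0 < x \<and> poly P x = 0)"

end

theory Submission
  imports Defs
begin

text \<open>
  Let \<open>Q\<close> have nonnegative coefficients bounded by \<open>M\<close>, no constant term, and some nonzero
  coefficient. For \<open>y = 1 / (M + 1)\<close> the telescoping identity \<open>M * y ^ (k + 1) = y ^ k - y ^ (k + 1)\<close>
  gives \<open>Q y \<le> 1 - y ^ n < 1\<close> for \<open>n\<close> at least the degree of \<open>Q\<close>. As \<open>Q\<close> increases strictly on
  the positive axis, the root of \<open>1 - Q\<close> lies to the right of \<open>y\<close>. The four polynomials have
  nonzero linear coefficient: a connected graph with three vertices has two adjacent edges.
\<close>

lemma poly_gen_poly: "poly (gen_poly c) x = (\<Sum>k | 1 \<le> k \<and> c k \<noteq> 0. real (c k) * x ^ k)"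
  by (simp add: gen_poly_def poly_sum poly_monom)

lemma poly_gen_poly_strict_mono:
  assumes "finite {k. 1 \<le> k \<and> c k \<noteq> 0}" and "1 \<le> j" "c j \<noteq> 0" and "0 \<le> x" "x < y"
  shows "poly (gen_poly c) x < poly (gen_poly c) y"
  unfolding poly_gen_poly
proof (rule sum_strict_mono)
  show "{k. 1 \<le> k \<and> c k \<noteq> 0} \<noteq> {}" using assms by auto
  fix k assume "k \<in> {k. 1 \<le> k \<and> c k \<noteq> 0}"
  then show "real (c k) * x ^ k < real (c k) * y ^ k"
    using assms by (auto intro!: power_strict_mono)
qed (rule assms)

text \<open>\<open>Max\<close> is meaningful only on a finite set: off the support \<open>c\<close>
  takes just the value 0, so finite support gives a finite range.\<close>

lemma le_max_coeff:
  assumes "finite {k. 1 \<le> k \<and> c k \<noteq> 0}" and "1 \<le> k"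
  shows "c k \<le> max_coeff c"
proof -
  have "c ` {1..} \<subseteq> insert 0 (c ` {k. 1 \<le> k \<and> c k \<noteq> 0})" by auto
  then have "finite (c ` {1..})"
    using assms(1) by (meson finite.insertI finite_imageI finite_subset)
  then show ?thesis using assms(2) unfolding max_coeff_def by (intro Max_ge) auto
qed

lemma poly_gen_poly_less_1:
  assumes fin: "finite {k. 1 \<le> k \<and> c k \<noteq> 0}"
  shows "poly (gen_poly c) (1 / (real (max_coeff c) + 1)) < 1"
proof -
  define M where "M = real (max_coeff c)"
  define y where "y = 1 / (M + 1)"
  have M0: "0 \<le> M" by (simp add: M_def)
  then have y0: "0 < y" and My: "M * y = 1 - y" by (simp_all add: y_def field_simps)
  obtain n where n: "{k. 1 \<le> k \<and> c k \<noteq> 0} \<subseteq> {..n}"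
    using fin finite_nat_iff_bounded_le by auto
  have tele: "(\<Sum>k=1..n. M * y ^ k) = 1 - y ^ n"
  proof (induction n)
    case (Suc n)
    have "M * y ^ Suc n = (M * y) * y ^ n" by simp
    also have "\<dots> = y ^ n - y ^ Suc n" by (simp add: My algebra_simps)
    finally show ?case using Suc by simp
  qed simp
  have "poly (gen_poly c) y \<le> (\<Sum>k | 1 \<le> k \<and> c k \<noteq> 0. M * y ^ k)"
    unfolding poly_gen_poly
    using le_max_coeff[OF fin] y0 by (intro sum_mono mult_right_mono) (auto simp: M_def)
  \<comment> \<open>Gaps in the support are filled with nonnegative terms to reach the full
    geometric sum.\<close>
  also have "\<dots> \<le> (\<Sum>k=1..n. M * y ^ k)"
    using n M0 y0 by (intro sum_mono2) auto
  also have "\<dots> < 1" using tele y0 by simp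
  finally show ?thesis by (simp add: y_def M_def)
qed

lemma pos_root_star_gen_poly_gt:
  assumes fin: "finite {k. 1 \<le> k \<and> c k \<noteq> 0}" and j: "1 \<le> j" "c j \<noteq> 0"
  shows "1 / (real (max_coeff c) + 1) < pos_root (star (gen_poly c))"
proof -
  let ?Q = "gen_poly c"
  let ?y = "1 / (real (max_coeff c) + 1)"
  note mono = poly_gen_poly_strict_mono[of c j, OF fin j]
  have y: "0 < ?y" "?y \<le> 1" by simp_all
  \<comment> \<open>A nonzero natural coefficient is at least 1, so the value at 1 is at least 1.
    The value at \<open>?y\<close> is below 1, hence the intermediate value theorem applies on the
    interval from \<open>?y\<close> to 1.\<close>
  have "1 \<le> real (c j) * 1 ^ j" using j by simp
  also have "\<dots> \<le> poly ?Q 1"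
    unfolding poly_gen_poly using fin j by (intro member_le_sum) auto
  finally have "\<exists>x\<ge>?y. x \<le> 1 \<and> poly ?Q x = 1"
    using poly_gen_poly_less_1[OF fin] y(2) by (intro IVT') (auto intro!: continuous_intros)
  then obtain x where x: "?y \<le> x" "poly ?Q x = 1" by blast
  have x0: "0 < x" using y(1) x(1) by linarith
  have "pos_root (star ?Q) = x"
    unfolding pos_root_def
  proof (rule the_equality)
    show "0 < x \<and> poly (star ?Q) x = 0" using x x0 by (simp add: star_def)
    fix z assume "0 < z \<and> poly (star ?Q) z = 0"
    then have "0 < z" "poly ?Q z = 1" by (simp_all add: star_def)
    then show "z = x" using mono[of x z] mono[of z x] x x0 by (cases z x rule: linorder_cases) auto
  qed
  moreover have "?y \<noteq> x" using x(2) poly_gen_poly_less_1[OF fin] by auto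
  ultimately show ?thesis using x(1) by simp
qed

lemma finite_vertex_pairs: "finite (verts G) \<Longrightarrow> finite (vertex_pairs G k)"
  by (rule finite_subset[of _ "Pow (verts G)"]) (auto simp: vertex_pairs_def)

text \<open>Each \<open>k\<close> in the support is the distance of some pair of vertices, and there
  are finitely many pairs. The condition on \<open>c\<close> is one that cardinalities of
  \<open>vertex_pairs G k\<close> and sums over it satisfy alike, which covers \<open>d_num\<close>,
  \<open>s_num\<close> and \<open>g_num\<close>.\<close>

lemma finite_vertex_pairs_support:
  assumes "finite (verts G)" and "\<And>k. c k \<noteq> 0 \<Longrightarrow> vertex_pairs G k \<noteq> {}"
  shows "finite {k. 1 \<le> k \<and> c k \<noteq> 0}"
proof (rule finite_imageD)
  let ?f = "\<lambda>k::nat. ereal (real k)"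
  have "?f ` {k. 1 \<le> k \<and> c k \<noteq> 0} \<subseteq> (\<lambda>(a, b). vertex_dist G a b) ` (verts G \<times> verts G)"
  proof
    fix z assume "z \<in> ?f ` {k. 1 \<le> k \<and> c k \<noteq> 0}"
    then obtain k where "z = ?f k" "vertex_pairs G k \<noteq> {}" using assms(2) by auto
    then show "z \<in> (\<lambda>(a, b). vertex_dist G a b) ` (verts G \<times> verts G)"
      by (force simp: vertex_pairs_def)
  qed
  then show "finite (?f ` {k. 1 \<le> k \<and> c k \<noteq> 0})"
    using assms(1) by (meson finite_SigmaI finite_imageI finite_subset)
qed (auto simp: inj_on_def)

text \<open>The arc itself is a walk of cost 1, and a walk between distinct vertices cannot be
  empty.\<close>

lemma vertex_dist_arc:
  assumes "wf_digraph G" and e: "e \<in> arcs G" and ne: "tail G e \<noteq> head G e"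
  shows "vertex_dist G (tail G e) (head G e) = 1"
proof -
  interpret wf_digraph G by fact
  have "\<mu> (\<lambda>_. 1) (tail G e) (head G e) \<le> 1"
    using min_cost_le_walk_cost[OF arc_implies_awalk[OF e], of "\<lambda>_. 1"] by (simp add: one_ereal_def)
  moreover have "1 \<le> \<mu> (\<lambda>_. 1) (tail G e) (head G e)"
    unfolding \<mu>_def
  proof (rule INF_greatest)
    fix p assume "p \<in> {p. awalk (tail G e) p (head G e)}"
    then have "p \<noteq> []" using ne by (auto simp: awalk_Nil_iff)
    then have "1 \<le> awalk_cost (\<lambda>_. 1) p"
      by (cases p) (auto simp: awalk_cost_def sum_list_triv)
    then show "1 \<le> ereal (awalk_cost (\<lambda>_. 1) p)" by (simp add: one_ereal_def)
  qed
  ultimately show ?thesis unfolding vertex_dist_def by (rule antisym)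
qed

lemma arc_in_vertex_pairs_1:
  assumes "wf_digraph G" "e \<in> arcs G" "tail G e \<noteq> head G e"
  shows "{tail G e, head G e} \<in> vertex_pairs G 1"
  using vertex_dist_arc[OF assms] assms wf_digraph.wellformed[of G e]
  by (auto simp: vertex_pairs_def one_ereal_def)

lemma wf_digraph_line_graph: "wf_digraph (line_graph G)"
  by unfold_locales (auto simp: line_graph_def)

text \<open>This reduces the edge version to the Hosoya polynomial of the line graph;
  \<open>Hosoya_root_bound\<close> is therefore stated for digraphs general enough to include both
  \<open>G\<close> and \<open>line_graph G\<close>.\<close>

lemma de_num_eq_d_num_line_graph: "de_num G = d_num (line_graph G)"
  by (rule ext)
    (simp add: de_num_def d_num_def edge_pairs_def vertex_pairs_def edge_dist_def line_graph_def)

lemma Hosoya_root_bound: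
  assumes "wf_digraph G" and fin: "finite (verts G)"
    and "e \<in> arcs G" "tail G e \<noteq> head G e"
  shows "1 / (real (max_coeff (d_num G)) + 1) < pos_root (star (gen_poly (d_num G)))"
proof (rule pos_root_star_gen_poly_gt)
  show "finite {k. 1 \<le> k \<and> d_num G k \<noteq> 0}"
    by (rule finite_vertex_pairs_support[OF fin]) (auto simp: d_num_def)
  show "d_num G 1 \<noteq> 0"
    using arc_in_vertex_pairs_1[OF assms(1,3,4)] finite_vertex_pairs[OF fin, of 1]
    by (auto simp: d_num_def)
qed simp

text \<open>If no arc left \<open>S\<close>, everything reachable from a vertex of \<open>S\<close>
  would stay in \<open>S\<close>, by induction along reachability.\<close>

lemma strongly_connected_leaving_arc:
  assumes "wf_digraph G" "strongly_connected G"
    and "S \<noteq> {}" "S \<subset> verts G"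
  shows "\<exists>e\<in>arcs G. tail G e \<in> S \<and> head G e \<notin> S"
proof (rule ccontr)
  interpret wf_digraph G by fact
  assume none: "\<not> ?thesis"
  obtain u v where uv: "u \<in> S" "v \<in> verts G" "v \<notin> S" using assms(3,4) by blast
  then have "u \<rightarrow>\<^sup>*\<^bsub>G\<^esub> v" using assms(2,4) by (auto simp: strongly_connected_def)
  then have "v \<in> S"
  proof (induction rule: reachable_induct)
    case (step x y)
    then show ?case using none by auto
  qed (use uv in simp)
  then show False using uv by simp
qed

text \<open>Two vertices never exhaust the graph. So some arc \<open>a\<close> leaves
  \<open>{u}\<close>, and some arc \<open>b\<close> leaves the two ends of \<open>a\<close>: the
  edges share the tail of \<open>b\<close> and differ because the head of \<open>b\<close> is
  new.\<close>

lemma line_graph_arc_exists: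
  assumes "wf_digraph G" "strongly_connected G" "card (verts G) \<ge> 3"
  shows "\<exists>e f. e \<noteq> f \<and> (e, f) \<in> arcs (line_graph G)"
proof -
  interpret wf_digraph G by fact
  have ex: "\<exists>e\<in>arcs G. tail G e \<in> S \<and> head G e \<notin> S"
    if "S \<noteq> {}" "S \<subseteq> verts G" "card S \<le> 2" for S
  proof (rule strongly_connected_leaving_arc[OF assms(1,2) that(1)])
    show "S \<subset> verts G" using that assms(3) by auto
  qed
  obtain u where u: "u \<in> verts G" using assms(3) by fastforce
  obtain a where a: "a \<in> arcs G" "tail G a = u" "head G a \<noteq> u"
    using ex[of "{u}"] u by auto
  obtain b where b: "b \<in> arcs G" "tail G b \<in> {u, head G a}" "head G b \<notin> {u, head G a}"
    using ex[of "{u, head G a}"] u a by (auto simp: card_insert_if)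
  let ?e = "{tail G a, head G a}" and ?f = "{tail G b, head G b}"
  have arcI: "(x, y) \<in> arcs (line_graph G)"
    if "x \<in> edges_of G" "y \<in> edges_of G" "x \<noteq> y" "x \<inter> y \<noteq> {}" for x y
    using that by (simp add: line_graph_def)
  have ne: "?e \<noteq> ?f" using b(3) a(2) by blast
  have "(?e, ?f) \<in> arcs (line_graph G)"
  proof (rule arcI[OF _ _ ne])
    show "?e \<inter> ?f \<noteq> {}" using a(2) b(2) by blast
  qed (use a(1) b(1) in \<open>simp_all add: edges_of_def\<close>)
  with ne show ?thesis by (intro exI conjI)
qed

theorem theorem8:
  fixes G :: "('a, 'b) pre_digraph"
  assumes "graph G"
    and "Digraph_Component.connected G"
    and "card (verts G) \<ge> 3"
  shows "pos_root (star (Hosoya G)) > 1 / (real (MH G) + 1)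
    \<and> pos_root (star (Schultz G)) > 1 / (real (MS G) + 1)
    \<and> pos_root (star (Gutman G)) > 1 / (real (MG G) + 1)
    \<and> pos_root (star (edge_Hosoya G)) > 1 / (real (MHe G) + 1)"
proof -
  interpret graph G by fact
  have wf: "wf_digraph G" by unfold_locales
  have sc: "strongly_connected G"
    using symmetric_connected_imp_strongly_connected[OF sym_arcs assms(2)] .
  \<comment> \<open>This pair is used twice: as an arc of the line graph for
    \<open>edge_Hosoya\<close>, and to supply an arc of \<open>G\<close> for the other three
    polynomials.\<close>
  obtain e f where ef: "e \<noteq> f" "(e, f) \<in> arcs (line_graph G)"
    using line_graph_arc_exists[OF wf sc assms(3)] by blast
  then obtain a where a: "a \<in> arcs G" by (auto simp: line_graph_def edges_of_def)
  \<comment> \<open>Degrees are out-degrees, so the head of \<open>a\<close> gets positive degree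
    from the arc opposite to \<open>a\<close>.\<close>
  obtain b where b: "b \<in> arcs G" "tail G b = head G a"
    using a sym_arcs by (auto simp: symmetric_conv)
  have loop: "tail G a \<noteq> head G a" using a no_loops by blast
  let ?p = "{tail G a, head G a}"
  have p: "?p \<in> vertex_pairs G 1" by (rule arc_in_vertex_pairs_1[OF wf a loop])
  have fin: "finite (vertex_pairs G 1)" by (rule finite_vertex_pairs) simp
  have deg: "degree_of G (tail G a) > 0" "degree_of G (head G a) > 0"
    unfolding degree_of_def out_degree_def using a b
    by (auto simp: card_gt_0_iff finite_out_arcs out_arcs_def)
  \<comment> \<open>A finite sum of naturals vanishes only if every term does, so the term of the
    adjacent pair \<open>?p\<close> alone makes the linear coefficient nonzero.\<close>
  have "(\<Sum>v\<in>?p. degree_of G v) \<noteq> 0" using deg by simp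
  then have "s_num G 1 \<noteq> 0"
    using p fin unfolding s_num_def by (metis sum_eq_0_iff)
  then have S: "1 / (real (max_coeff (s_num G)) + 1) < pos_root (star (gen_poly (s_num G)))"
    by (intro pos_root_star_gen_poly_gt[of _ 1] finite_vertex_pairs_support[of G])
      (auto simp: s_num_def)
  have "(\<Prod>v\<in>?p. degree_of G v) \<noteq> 0" using deg by simp
  then have "g_num G 1 \<noteq> 0"
    using p fin unfolding g_num_def by (metis sum_eq_0_iff)
  then have Gt: "1 / (real (max_coeff (g_num G)) + 1) < pos_root (star (gen_poly (g_num G)))"
    by (intro pos_root_star_gen_poly_gt[of _ 1] finite_vertex_pairs_support[of G])
      (auto simp: g_num_def)
  have "1 / (real (max_coeff (de_num G)) + 1) < pos_root (star (gen_poly (de_num G)))"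
    unfolding de_num_eq_d_num_line_graph
    using ef by (intro Hosoya_root_bound[OF wf_digraph_line_graph, of _ "(e, f)"])
      (auto simp: line_graph_def edges_of_def)
  then show ?thesis
    using Hosoya_root_bound[OF wf _ a loop] S Gt
    by (simp add: Hosoya_def Schultz_def Gutman_def edge_Hosoya_def MH_def MS_def MG_def MHe_def)
qed

end
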